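(* Let $\theta=\theta^*:=\dfrac{\sqrt{\alpha_2\lambda_2}}{\sqrt{\alpha_1\lambda_1}+\sqrt{\alpha_2\lambda_2}}$ and suppose $\sqrt{\alpha_1/\lambda_1}\,a>\sqrt{\alpha_2/\lambda_2}\,b$. Then for every $k\ge1$ the error $\boldsymbol{h}^k$ of the time discrete (implicit Euler) Dirichlet--Neumann waveform relaxation iteration satisfies $$\|\boldsymbol{h}^k\|_{l^2}\le\left(2\,\frac{1-\sqrt{\frac{\alpha_2\lambda_1}{\alpha_1\lambda_2}}\frac{b}{a}}{1+\sqrt{\frac{\alpha_2\lambda_2}{\alpha_1\lambda_1}}}\right)^k\phi_1(r_{1d}^* )\,\|\boldsymbol{h}^0\|_{l^2},$$ where $$\phi_1(r)=\exp\left(rT-kb\sqrt{\frac{\alpha_2}{\lambda_2}}\sqrt{\frac{1-e^{-r\Delta t}}{\Delta t}}\right),\qquad r_{1d}^*=\frac1{\Delta t}\log\left(\frac{1+\sqrt{\frac{\alpha_2\Delta t}{\lambda_2T^2}b^2k^2+1}}{2}\right).$$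
   Context: Let $a,b,T>0$, $\alpha_j,\lambda_j>0$ ($j=1,2$), $N\in\mathbb{N}$, $N\geq 1$, $\Delta t=T/N$. The time discrete DNWR iteration discretizes in time by implicit Euler (space is kept continuous). By linearity, its error is described by the iteration with all sources, initial data and outer boundary data equal to zero: given an arbitrary initial interface error $\boldsymbol{h}^0=(h^{1,0},\dots,h^{N,0})\in\mathbb{R}^N$, for $k=0,1,2,\dots$ and $n=0,\dots,N-1$, with $u_1^{0,k+1}=0$ and $u_2^{0,k+1}=0$, solve the two-point boundary value problems $$\frac{\alpha_1}{\Delta t}\left(u_1^{n+1,k+1}-u_1^{n,k+1}\right)-\lambda_1\partial_{xx}u_1^{n+1,k+1}=0\ \text{in }(-a,0),\quad u_1^{n+1,k+1}(-a)=0,\quad u_1^{n+1,k+1}(0)=h^{n+1,k},$$ $$\frac{\alpha_2}{\Delta t}\left(u_2^{n+1,k+1}-u_2^{n,k+1}\right)-\lambda_2\partial_{xx}u_2^{n+1,k+1}=0\ \text{in }(0,b),\quad -\lambda_2\partial_xu_2^{n+1,k+1}(0)=-\lambda_1\partial_xu_1^{n+1,k+1}(0),\quad u_2^{n+1,k+1}(b)=0,$$ and update $h^{n+1,k+1}=(1-\theta)h^{n+1,k}+\theta u_2^{n+1,k+1}(0)$, where $\theta\in(0,1)$ is the relaxation parameter. Write $\boldsymbol{h}^k=(h^{1,k},\dots,h^{N,k})$ and $\|\boldsymbol{h}^k\|_{l^2}^2=\sum_{n=1}^N(h^{n,k})^2$. *)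

theory Defs
  imports "HOL-Analysis.Analysis"
begin

text \<open>
  Classical solutions \<open>u\<close> of one implicit Euler step of the homogeneous heat equation on the
  interval \<open>(l, r)\<close>, where \<open>v\<close> is the previous time level. No regularity beyond continuity up to
  the end points is imposed there; \<open>u''\<close> is automatically continuous inside by the equation.
\<close>
definition heat_step ::
  "real \<Rightarrow> real \<Rightarrow> real \<Rightarrow> real \<Rightarrow> real \<Rightarrow> (real \<Rightarrow> real) \<Rightarrow> (real \<Rightarrow> real) \<Rightarrow> bool" where
  "heat_step \<alpha> lam \<Delta>t l r v u \<longleftrightarrow>
     continuous_on {l..r} u \<and>
     (\<exists>u' u''. \<forall>x\<in>{l<..<r}.
        (u has_real_derivative u' x) (at x) \<and>
        (u' has_real_derivative u'' x) (at x) \<and>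
        \<alpha> / \<Delta>t * (u x - v x) - lam * u'' x = 0)"

text \<open>
  Error iteration of the time discrete Dirichlet--Neumann waveform relaxation method with \<open>N\<close>
  implicit Euler steps of size \<open>\<Delta>t\<close>. The iteration index comes first: \<open>h k n\<close> is the interface error at time level \<open>n\<close> and iterate \<open>k\<close>
  (relevant for \<open>1 \<le> n \<le> N\<close>), and \<open>u1 k n\<close>, \<open>u2 k n\<close> are the subdomain errors
  (relevant for \<open>1 \<le> k\<close> and \<open>n \<le> N\<close>). The functions are only constrained on their respective
  space intervals, so the fluxes at the interface are one-sided derivatives.
\<close>
definition dnwr_error_iteration ::
  "real \<Rightarrow> real \<Rightarrow> real \<Rightarrow> real \<Rightarrow> real \<Rightarrow> real \<Rightarrow> real \<Rightarrow> nat \<Rightarrow> real \<Rightarrow>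
   (nat \<Rightarrow> nat \<Rightarrow> real) \<Rightarrow> (nat \<Rightarrow> nat \<Rightarrow> real \<Rightarrow> real) \<Rightarrow> (nat \<Rightarrow> nat \<Rightarrow> real \<Rightarrow> real) \<Rightarrow> bool" where
  "dnwr_error_iteration a b \<alpha>\<^sub>1 lam\<^sub>1 \<alpha>\<^sub>2 lam\<^sub>2 \<Delta>t N \<theta> h u1 u2 \<longleftrightarrow>
     (\<forall>k. (\<forall>x\<in>{-a..0}. u1 (k + 1) 0 x = 0) \<and>
          (\<forall>x\<in>{0..b}. u2 (k + 1) 0 x = 0) \<and>
          (\<forall>n<N.
             heat_step \<alpha>\<^sub>1 lam\<^sub>1 \<Delta>t (-a) 0 (u1 (k + 1) n) (u1 (k + 1) (n + 1)) \<and>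
             u1 (k + 1) (n + 1) (-a) = 0 \<and>
             u1 (k + 1) (n + 1) 0 = h k (n + 1) \<and>
             heat_step \<alpha>\<^sub>2 lam\<^sub>2 \<Delta>t 0 b (u2 (k + 1) n) (u2 (k + 1) (n + 1)) \<and>
             (\<exists>p1 p2. (u1 (k + 1) (n + 1) has_real_derivative p1) (at_left 0) \<and>
                      (u2 (k + 1) (n + 1) has_real_derivative p2) (at_right 0) \<and>
                      - lam\<^sub>2 * p2 = - lam\<^sub>1 * p1) \<and>
             u2 (k + 1) (n + 1) b = 0 \<and>
             h (k + 1) (n + 1) = (1 - \<theta>) * h k (n + 1) + \<theta> * u2 (k + 1) (n + 1) 0))"

definition phi1 :: "real \<Rightarrow> real \<Rightarrow> real \<Rightarrow> real \<Rightarrow> real \<Rightarrow> nat \<Rightarrow> real \<Rightarrow> real" where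
  "phi1 b \<alpha>\<^sub>2 lam\<^sub>2 T \<Delta>t k r =
     exp (r * T - real k * b * sqrt (\<alpha>\<^sub>2 / lam\<^sub>2) * sqrt ((1 - exp (- r * \<Delta>t)) / \<Delta>t))"

definition r1d :: "real \<Rightarrow> real \<Rightarrow> real \<Rightarrow> real \<Rightarrow> real \<Rightarrow> nat \<Rightarrow> real" where
  "r1d b \<alpha>\<^sub>2 lam\<^sub>2 T \<Delta>t k =
     1 / \<Delta>t * ln ((1 + sqrt (\<alpha>\<^sub>2 * \<Delta>t / (lam\<^sub>2 * T\<^sup>2) * b\<^sup>2 * (real k)\<^sup>2 + 1)) / 2)"

end

theory Submission imports Defs begin

text \<open>
  The idea is an energy method in place of a transform in time. For a weight \<open>0 \<le> R \<le> 1\<close> and a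
  homogeneous implicit Euler solution \<open>u\<close> with zero initial data let
  \<open>W x\<close> be the \<open>l\<^sup>2\<close> norm over the time levels of \<open>R ^ n * u n x\<close>. Since \<open>R\<close> discounts each
  time step, the backward difference is coercive with constant \<open>(1 - R) / \<Delta>t\<close>
  (\<open>implicit_euler_coercive\<close>). Together with the Cauchy--Schwarz inequality this makes \<open>W\<close> a
  subsolution of the stationary equation, \<open>W'' \<ge> \<mu> W\<close> wherever \<open>W > 0\<close>, with
  \<open>\<mu> = \<alpha> / (lam * \<Delta>t) * (1 - R)\<close>. Hence \<open>W\<close> can be compared with explicit functions:
  for every positive \<open>p\<close> with \<open>p'' \<le> \<mu> p\<close> the function \<open>p\<^sup>2 (W\<^sup>2 / p\<^sup>2)'\<close> is nondecreasing
  (\<open>heat_evolution_quotient_deriv\<close>), so that \<open>W / p\<close> is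
  bounded on an interval by the larger of its two boundary values.

  With linear \<open>p\<close> this bounds the norm of a solution that vanishes at one end by the linear
  interpolation of its boundary values (\<open>heat_dirichlet_contraction\<close>). With
  \<open>p x = cosh (sqrt \<mu> * x)\<close> it shows that the norm of a solution with zero flux at \<open>0\<close> is smaller
  there than at \<open>b\<close> by the factor \<open>1 / cosh (sqrt \<mu> * b)\<close> (\<open>heat_neumann_contraction\<close>).

  One step of the iteration is the composition of two such problems. Fold the left subdomain
  onto the right one by \<open>x \<mapsto> - c * x\<close>, where \<open>c = sqrt (\<alpha>\<^sub>2 * lam\<^sub>1 / (\<alpha>\<^sub>1 * lam\<^sub>2))\<close>
  equalises the two diffusivities, and put \<open>d n x = u1 n (- c * x) + s * u2 n x\<close> with
  \<open>s = sqrt (\<alpha>\<^sub>2 * lam\<^sub>2 / (\<alpha>\<^sub>1 * lam\<^sub>1))\<close>. Then \<open>d\<close> solves the heat equation of the right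
  subdomain, the transmission condition says that its flux at \<open>0\<close> vanishes, and its value at
  \<open>b\<close> is \<open>u1 n (- c * b)\<close>. For the relaxation parameter \<open>\<theta>\<^sup>*\<close> the updated interface value is
  exactly \<open>(1 - \<theta>\<^sup>*) * d n 0\<close>. The two comparison results therefore bound the weighted norm
  of the new error by \<open>(1 - \<theta>\<^sup>*) * (1 - c * b / a) / cosh (sqrt \<mu> * b)\<close> times that of the old
  one (\<open>dnwr_step_contraction\<close>), and \<open>1 / cosh y \<le> 2 * exp (- y)\<close>.

  Passing from the weighted to the plain norm after \<open>k\<close> steps costs a factor \<open>R ^ (- N)\<close>. With
  \<open>R = exp (- r * \<Delta>t)\<close> this is \<open>exp (r * T)\<close>, and the factors combine to \<open>phi1\<close>. This holds
  for every \<open>r \<ge> 0\<close>, and \<open>r1d\<close> is the value of \<open>r\<close> that minimises \<open>phi1\<close>.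
\<close>

section \<open>Weighted norms in time\<close>

text \<open>
  For \<open>R = exp (- r * \<Delta>t)\<close> the weight is \<open>exp (- r * t)\<close> at the time levels \<open>t = n * \<Delta>t\<close>, which
  plays the role of evaluating a transform in time at real part \<open>r\<close>.
\<close>
definition wnorm :: "real \<Rightarrow> nat \<Rightarrow> (nat \<Rightarrow> real) \<Rightarrow> real" where
  "wnorm R N f = L2_set (\<lambda>n. R ^ n * f n) {1..N}"

lemma wnorm_nonneg: "0 \<le> wnorm R N f"
  by (simp add: wnorm_def)

lemma wnorm_sq: "(wnorm R N f)\<^sup>2 = (\<Sum>n=1..N. (R ^ n * f n)\<^sup>2)"
  by (simp add: wnorm_def L2_set_def sum_nonneg)

lemma wnorm_scale: "0 \<le> c \<Longrightarrow> wnorm R N (\<lambda>n. c * f n) = c * wnorm R N f"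
  by (simp add: wnorm_def L2_set_right_distrib mult.left_commute)

lemma wnorm_cong: "(\<And>n. 1 \<le> n \<Longrightarrow> n \<le> N \<Longrightarrow> f n = g n) \<Longrightarrow> wnorm R N f = wnorm R N g"
  unfolding wnorm_def by (rule L2_set_cong) auto

text \<open>
  Summing \<open>v n * v (n - 1) \<le> ((v n)\<^sup>2 + (v (n - 1))\<^sup>2) / 2\<close> over \<open>n\<close> gives the claim; the
  unmatched boundary term \<open>R / 2 * (v N)\<^sup>2\<close> is kept to make the induction work.
\<close>
lemma implicit_euler_coercive:
  fixes v :: "nat \<Rightarrow> real"
  assumes "v 0 = 0" and "0 \<le> R"
  shows "(1 - R) * (\<Sum>n=1..N. (v n)\<^sup>2) \<le> (\<Sum>n=1..N. v n * (v n - R * v (n - 1)))"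
proof -
  have "(1 - R) * (\<Sum>n=1..N. (v n)\<^sup>2) + R / 2 * (v N)\<^sup>2
      \<le> (\<Sum>n=1..N. v n * (v n - R * v (n - 1)))"
  proof (induction N)
    case 0
    then show ?case using assms by simp
  next
    case (Suc N)
    have "0 \<le> R / 2 * (v (Suc N) - v N)\<^sup>2"
      using assms by simp
    with Suc show ?case
      by (simp add: power2_eq_square algebra_simps)
  qed
  moreover have "0 \<le> R / 2 * (v N)\<^sup>2"
    using assms by simp
  ultimately show ?thesis by linarith
qed

lemma L2_set_le_wnorm:
  assumes "0 < R" "R \<le> 1"
  shows "R ^ N * L2_set f {1..N} \<le> wnorm R N f"
proof -
  have "R ^ N * L2_set f {1..N} = L2_set (\<lambda>n. R ^ N * \<bar>f n\<bar>) {1..N}"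
    using assms by (simp add: L2_set_right_distrib[symmetric]) (simp add: L2_set_def)
  also have "\<dots> \<le> L2_set (\<lambda>n. \<bar>R ^ n * f n\<bar>) {1..N}"
    using assms
    by (intro L2_set_mono) (auto simp: abs_mult intro!: mult_right_mono power_decreasing)
  also have "\<dots> = wnorm R N f"
    by (simp add: wnorm_def L2_set_def)
  finally show ?thesis .
qed

lemma wnorm_le_L2_set:
  assumes "0 \<le> R" "R \<le> 1"
  shows "wnorm R N f \<le> L2_set f {1..N}"
proof -
  have "wnorm R N f = L2_set (\<lambda>n. \<bar>R ^ n * f n\<bar>) {1..N}"
    by (simp add: wnorm_def L2_set_def)
  also have "\<dots> \<le> L2_set (\<lambda>n. \<bar>f n\<bar>) {1..N}"
    using assms
    by (intro L2_set_mono) (auto simp: abs_mult power_le_one intro!: mult_left_le_one_le)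
  also have "\<dots> = L2_set f {1..N}"
    by (simp add: L2_set_def)
  finally show ?thesis .
qed

section \<open>Comparison for solutions of the implicit Euler heat equation\<close>

definition heat_evolution ::
  "real \<Rightarrow> real \<Rightarrow> real \<Rightarrow> real \<Rightarrow> real \<Rightarrow> nat \<Rightarrow> (nat \<Rightarrow> real \<Rightarrow> real) \<Rightarrow> bool" where
  "heat_evolution \<alpha> lam \<Delta>t l r N u \<longleftrightarrow>
     (\<forall>x\<in>{l..r}. u 0 x = 0) \<and> (\<forall>n<N. heat_step \<alpha> lam \<Delta>t l r (u n) (u (n + 1)))"

lemma heat_evolution_step:
  assumes "heat_evolution \<alpha> lam \<Delta>t l r N u" and "n \<in> {1..N}"
  shows "heat_step \<alpha> lam \<Delta>t l r (u (n - 1)) (u n)"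
proof -
  have "n - 1 < N" and "n - 1 + 1 = n" using assms(2) by auto
  then show ?thesis using assms(1) unfolding heat_evolution_def by metis
qed

lemma heat_evolution_continuous:
  assumes "heat_evolution \<alpha> lam \<Delta>t l r N u"
  shows "continuous_on {l..r} (\<lambda>x. (wnorm R N (\<lambda>n. u n x))\<^sup>2)"
  unfolding wnorm_sq
  by (intro continuous_intros)
     (use heat_evolution_step[OF assms] in \<open>auto simp: heat_step_def\<close>)

text \<open>
  Write \<open>F = W\<^sup>2\<close>, where \<open>W\<close> is the weighted norm. Then
  \<open>H = p\<^sup>2 (F / p\<^sup>2)' = F' - 2 F p' / p\<close>. With \<open>v n = R ^ n * u n\<close>, its derivative is twice
  the sum of \<open>\<Sum>n. (v n' - v n p' / p)\<^sup>2\<close> and \<open>(\<Sum>n. v n v n'') - F p'' / p\<close>. The first part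
  is a sum of squares, and the second is nonnegative by coercivity and the condition on \<open>p''\<close>.
  Working with \<open>W\<^sup>2\<close> instead of \<open>W\<close> avoids the points where \<open>W\<close> vanishes and is not smooth.
\<close>
lemma heat_evolution_quotient_deriv:
  fixes p p' p'' :: "real \<Rightarrow> real"
  assumes u: "heat_evolution \<alpha> lam \<Delta>t l r N u"
    and pos: "\<alpha> > 0" "lam > 0" "\<Delta>t > 0" "R \<ge> 0"
    and p: "\<And>x. x \<in> {l<..<r} \<Longrightarrow> p x > 0"
    and dp: "\<And>x. x \<in> {l<..<r} \<Longrightarrow> (p has_real_derivative p' x) (at x)"
    and ddp: "\<And>x. x \<in> {l<..<r} \<Longrightarrow> (p' has_real_derivative p'' x) (at x)"
    and super: "\<And>x. x \<in> {l<..<r} \<Longrightarrow> p'' x \<le> \<alpha> / (lam * \<Delta>t) * (1 - R) * p x"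
  obtains H where "\<And>x y. l < x \<Longrightarrow> x \<le> y \<Longrightarrow> y < r \<Longrightarrow> H x \<le> H y"
    and "\<And>x. x \<in> {l<..<r} \<Longrightarrow>
      ((\<lambda>x. (wnorm R N (\<lambda>n. u n x))\<^sup>2 / (p x)\<^sup>2) has_real_derivative H x / (p x)\<^sup>2) (at x)"
proof -
  let ?S = "{1..N}"
  have "\<exists>f g. \<forall>x\<in>{l<..<r}. (u n has_real_derivative f x) (at x) \<and>
      (f has_real_derivative g x) (at x) \<and>
      \<alpha> / \<Delta>t * (u n x - u (n - 1) x) - lam * g x = 0" if "n \<in> ?S" for n
    using heat_evolution_step[OF u that] by (simp add: heat_step_def)
  then obtain f g where fg: "\<And>n x. n \<in> ?S \<Longrightarrow> x \<in> {l<..<r} \<Longrightarrow>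
      (u n has_real_derivative f n x) (at x) \<and> (f n has_real_derivative g n x) (at x) \<and>
      \<alpha> / \<Delta>t * (u n x - u (n - 1) x) - lam * g n x = 0"
    by metis
  have g_eq: "g n x = \<alpha> / (lam * \<Delta>t) * (u n x - u (n - 1) x)"
    if "n \<in> ?S" "x \<in> {l<..<r}" for n x
    using fg[OF that] pos by (simp add: field_simps)
  define v where "v n x = R ^ n * u n x" for n x
  define v' where "v' n x = R ^ n * f n x" for n x
  define v'' where "v'' n x = R ^ n * g n x" for n x
  define F where "F x = (\<Sum>n\<in>?S. (v n x)\<^sup>2)" for x
  define F' where "F' x = (\<Sum>n\<in>?S. 2 * v n x * v' n x)" for x
  have dv: "(v n has_real_derivative v' n x) (at x)"
      "(v' n has_real_derivative v'' n x) (at x)" if "n \<in> ?S" "x \<in> {l<..<r}" for n x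
    using fg[OF that] unfolding v_def[abs_def] v'_def[abs_def] v''_def
    by (auto intro!: DERIV_cmult)
  have dF: "(F has_real_derivative F' x) (at x)" if "x \<in> {l<..<r}" for x
    unfolding F_def[abs_def] F'_def
    by (rule DERIV_sum) (use that in \<open>auto intro!: derivative_eq_intros dv\<close>)
  define F'' where "F'' x = (\<Sum>n\<in>?S. 2 * ((v' n x)\<^sup>2 + v n x * v'' n x))" for x
  have ddF: "(F' has_real_derivative F'' x) (at x)" if "x \<in> {l<..<r}" for x
    unfolding F'_def[abs_def] F''_def
    by (rule DERIV_sum)
       (use that in \<open>auto intro!: derivative_eq_intros dv simp: power2_eq_square algebra_simps\<close>)
  define H where "H x = F' x - 2 * F x * p' x / p x" for x
  define H' where "H' x = F'' x - 2 * F' x * p' x / p x - 2 * F x * p'' x / p x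
      + 2 * F x * (p' x)\<^sup>2 / (p x)\<^sup>2" for x
  have dH: "(H has_real_derivative H' x) (at x)" if x: "x \<in> {l<..<r}" for x
    unfolding H_def[abs_def] H'_def
    using p[OF x]
    by (auto intro!: derivative_eq_intros dF[OF x] ddF[OF x] dp[OF x] ddp[OF x]
        simp: power2_eq_square field_simps)
  have H'_nonneg: "0 \<le> H' x" if x: "x \<in> {l<..<r}" for x
  proof -
    define \<mu> where "\<mu> = \<alpha> / (lam * \<Delta>t)"
    have mu: "\<mu> > 0" using pos by (simp add: \<mu>_def)
    have px: "p x > 0" using p[OF x] .
    have u0: "v 0 x = 0"
      using u x by (auto simp: heat_evolution_def v_def)
    have "\<mu> * (1 - R) * F x \<le> \<mu> * (\<Sum>n\<in>?S. v n x * (v n x - R * v (n - 1) x))"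
      using mult_left_mono[OF implicit_euler_coercive[of "\<lambda>n. v n x", OF u0 pos(4), of N], of \<mu>] mu
      by (simp add: F_def mult.assoc)
    also have "\<dots> = (\<Sum>n\<in>?S. v n x * v'' n x)"
      unfolding sum_distrib_left
    proof (rule sum.cong)
      fix n assume n: "n \<in> ?S"
      then obtain m where m: "n = Suc m" by (cases n) auto
      show "\<mu> * (v n x * (v n x - R * v (n - 1) x)) = v n x * v'' n x"
        unfolding v''_def g_eq[OF n x] \<mu>_def[symmetric] by (simp add: v_def m algebra_simps)
    qed simp
    finally have coercive: "\<mu> * (1 - R) * F x \<le> (\<Sum>n\<in>?S. v n x * v'' n x)" .
    have "F x * (p'' x / p x) \<le> F x * (\<mu> * (1 - R))"
      using super[OF x] px
      by (intro mult_left_mono) (auto simp: F_def \<mu>_def sum_nonneg divide_le_eq)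
    with coercive have 1: "0 \<le> (\<Sum>n\<in>?S. v n x * v'' n x) - F x * (p'' x / p x)"
      by (simp add: mult.commute)
    have "0 \<le> (\<Sum>n\<in>?S. (v' n x - v n x * (p' x / p x))\<^sup>2)"
      by (intro sum_nonneg) simp
    also have "\<dots> = (\<Sum>n\<in>?S. (v' n x)\<^sup>2) - F' x * (p' x / p x) + F x * (p' x / p x)\<^sup>2"
      unfolding F_def F'_def sum_distrib_right sum_subtractf[symmetric] sum.distrib[symmetric]
      by (intro sum.cong) (auto simp: power2_eq_square algebra_simps)
    finally have 2: "0 \<le> (\<Sum>n\<in>?S. (v' n x)\<^sup>2) - F' x * (p' x / p x) + F x * (p' x / p x)\<^sup>2" .
    have "H' x = 2 * ((\<Sum>n\<in>?S. (v' n x)\<^sup>2) - F' x * (p' x / p x) + F x * (p' x / p x)\<^sup>2)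
        + 2 * ((\<Sum>n\<in>?S. v n x * v'' n x) - F x * (p'' x / p x))"
      unfolding H'_def F''_def sum_distrib_left[symmetric] sum.distrib
      by (simp add: power_divide algebra_simps)
    with 1 2 show ?thesis by simp
  qed
  show thesis
  proof (rule that)
    show "H x \<le> H y" if "l < x" "x \<le> y" "y < r" for x y
    proof (rule DERIV_nonneg_imp_nondecreasing[OF \<open>x \<le> y\<close>])
      fix t assume "x \<le> t" "t \<le> y"
      with that have "t \<in> {l<..<r}" by simp
      then show "\<exists>d. (H has_real_derivative d) (at t) \<and> 0 \<le> d"
        using dH H'_nonneg by blast
    qed
    show "((\<lambda>x. (wnorm R N (\<lambda>n. u n x))\<^sup>2 / (p x)\<^sup>2) has_real_derivative H x / (p x)\<^sup>2) (at x)"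
      if x: "x \<in> {l<..<r}" for x
    proof -
      have F_eq: "(wnorm R N (\<lambda>n. u n x))\<^sup>2 = F x" for x
        by (simp add: wnorm_sq F_def v_def)
      have "p x \<noteq> 0" using p[OF x] by simp
      then show ?thesis
        unfolding F_eq H_def
        by (auto intro!: derivative_eq_intros dF[OF x] dp[OF x]
            simp: power2_eq_square field_simps)
    qed
  qed
qed

section \<open>The Dirichlet and the Neumann subproblem\<close>

text \<open>
  The norm lies below the linear function with the same boundary values. That function vanishes
  at \<open>l\<close>, so the comparison is made with \<open>y - l + e\<close> before \<open>e\<close> tends to \<open>0\<close>. Since the
  derivative of the quotient \<open>G\<close> can only change sign from negative to positive, \<open>G x\<close> is bounded
  by the larger of its boundary values, and \<open>G l = 0\<close>.
\<close>
lemma heat_dirichlet_contraction: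
  assumes u: "heat_evolution \<alpha> lam \<Delta>t l r N u"
    and pos: "\<alpha> > 0" "lam > 0" "\<Delta>t > 0" and R: "0 \<le> R" "R \<le> 1"
    and bc: "\<And>n. 1 \<le> n \<Longrightarrow> n \<le> N \<Longrightarrow> u n l = 0"
    and x: "l < x" "x < r"
  shows "wnorm R N (\<lambda>n. u n x) \<le> (x - l) / (r - l) * wnorm R N (\<lambda>n. u n r)"
proof -
  define W where "W y = wnorm R N (\<lambda>n. u n y)" for y
  have W0: "0 \<le> W y" for y by (simp add: W_def wnorm_nonneg)
  have Wl: "W l = 0"
    using wnorm_cong[of N "\<lambda>n. u n l" "\<lambda>n. 0"] bc by (simp add: W_def wnorm_def L2_set_def)
  have eps: "(r - l + e) * W x \<le> (x - l + e) * W r" if e: "e > 0" for e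
  proof -
    define G where "G y = (W y)\<^sup>2 / (y - l + e)\<^sup>2" for y
    have coef: "0 \<le> \<alpha> / (lam * \<Delta>t) * (1 - R)"
      using pos R by simp
    obtain H where mono: "\<And>x y. l < x \<Longrightarrow> x \<le> y \<Longrightarrow> y < r \<Longrightarrow> H x \<le> H y"
      and "\<And>x. x \<in> {l<..<r} \<Longrightarrow> ((\<lambda>x. (wnorm R N (\<lambda>n. u n x))\<^sup>2 / (x - l + e)\<^sup>2)
          has_real_derivative H x / (x - l + e)\<^sup>2) (at x)"
      by (rule heat_evolution_quotient_deriv[OF u pos R(1),
            of "\<lambda>y. y - l + e" "\<lambda>_. 1" "\<lambda>_. 0"])
         (use e in \<open>auto intro!: derivative_eq_intros mult_nonneg_nonneg[OF coef]
            simp del: times_divide_eq_left\<close>)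
    then have dG: "(G has_real_derivative H y / (y - l + e)\<^sup>2) (at y)" if "y \<in> {l<..<r}" for y
      using that by (simp add: G_def[abs_def] W_def)
    have cG: "continuous_on {l..r} G"
      unfolding G_def W_def
      by (intro continuous_intros heat_evolution_continuous[OF u]) (use e in auto)
    have "G x \<le> max (G l) (G r)"
    proof (cases "H x \<le> 0")
      case True
      have "G x \<le> G l"
      proof (rule DERIV_nonpos_imp_decreasing_open[of l x G])
        show "l \<le> x" using x by simp
        show "continuous_on {l..x} G" using cG by (rule continuous_on_subset) (use x in auto)
        fix y assume y: "l < y" "y < x"
        have "H y \<le> 0" using mono[of y x] y x True by simp
        with dG[of y] y x show "\<exists>d. (G has_real_derivative d) (at y) \<and> d \<le> 0"
          by (auto intro!: exI divide_nonpos_nonneg)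
      qed
      then show ?thesis by simp
    next
      case False
      have "G x \<le> G r"
      proof (rule DERIV_nonneg_imp_increasing_open[of x r G])
        show "x \<le> r" using x by simp
        show "continuous_on {x..r} G" using cG by (rule continuous_on_subset) (use x in auto)
        fix y assume y: "x < y" "y < r"
        have "0 \<le> H y" using mono[of x y] y x False by simp
        with dG[of y] y x show "\<exists>d. (G has_real_derivative d) (at y) \<and> 0 \<le> d"
          by (auto intro!: exI divide_nonneg_nonneg)
      qed
      then show ?thesis by simp
    qed
    moreover have "G l = 0" "0 \<le> G r" by (simp_all add: G_def Wl)
    ultimately have "G x \<le> G r" by simp
    then have "(W x / (x - l + e))\<^sup>2 \<le> (W r / (r - l + e))\<^sup>2"
      by (simp add: G_def power_divide)
    then have "W x / (x - l + e) \<le> W r / (r - l + e)"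
      by (rule power2_le_imp_le) (use W0 x e in auto)
    then show ?thesis using x e by (simp add: field_simps)
  qed
  have "(r - l) * W x \<le> (x - l) * W r"
  proof (rule tendsto_le)
    show "((\<lambda>e. (x - l + e) * W r) \<longlongrightarrow> (x - l) * W r) (at_right 0)"
      by (auto intro!: tendsto_eq_intros)
    show "((\<lambda>e. (r - l + e) * W x) \<longlongrightarrow> (r - l) * W x) (at_right 0)"
      by (auto intro!: tendsto_eq_intros)
    show "\<forall>\<^sub>F e in at_right 0. (r - l + e) * W x \<le> (x - l + e) * W r"
      using eps by (auto simp: eventually_at_right_less intro: eventually_mono[OF eventually_at_right_less])
  qed simp
  then show ?thesis using x by (simp add: W_def field_simps)
qed

text \<open>
  The function \<open>x \<mapsto> cosh (q * x)\<close> has zero slope at \<open>0\<close>, and \<open>q\<close> is chosen so that it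
  solves the stationary equation exactly. The quotient \<open>G\<close> of the squares then has zero slope at \<open>0\<close>, and
  as \<open>(cosh (q * x))\<^sup>2 * G' x\<close> is nondecreasing, \<open>G\<close> increases from \<open>0\<close> to \<open>b\<close>.
\<close>
lemma heat_neumann_contraction:
  assumes d: "heat_evolution \<alpha> lam \<Delta>t 0 b N d"
    and pos: "\<alpha> > 0" "lam > 0" "\<Delta>t > 0" "b > 0" and R: "0 \<le> R" "R \<le> 1"
    and bc: "\<And>n. 1 \<le> n \<Longrightarrow> n \<le> N \<Longrightarrow> (d n has_real_derivative 0) (at_right 0)"
  shows "wnorm R N (\<lambda>n. d n 0)
    \<le> wnorm R N (\<lambda>n. d n b) / cosh (b * sqrt (\<alpha> / lam) * sqrt ((1 - R) / \<Delta>t))"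
proof -
  define q where "q = sqrt (\<alpha> / lam) * sqrt ((1 - R) / \<Delta>t)"
  have q0: "0 \<le> q" using pos R by (simp add: q_def)
  have q2: "q * q = \<alpha> / (lam * \<Delta>t) * (1 - R)"
  proof -
    have "q * q = (sqrt (\<alpha> / lam))\<^sup>2 * (sqrt ((1 - R) / \<Delta>t))\<^sup>2"
      unfolding q_def power2_eq_square by (simp only: mult_ac)
    also have "\<dots> = \<alpha> / lam * ((1 - R) / \<Delta>t)"
      using pos R by simp
    finally show ?thesis by simp
  qed
  have dcosh: "((\<lambda>y. cosh (q * y)) has_real_derivative q * sinh (q * y)) (at y)" for y
    by (auto intro!: derivative_eq_intros)
  have dsinh: "((\<lambda>y. q * sinh (q * y)) has_real_derivative q * q * cosh (q * y)) (at y)" for y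
    by (auto intro!: derivative_eq_intros)
  have super: "q * q * cosh (q * y) \<le> \<alpha> / (lam * \<Delta>t) * (1 - R) * cosh (q * y)" for y
    unfolding q2 by simp
  define G where "G y = (wnorm R N (\<lambda>n. d n y))\<^sup>2 / (cosh (q * y))\<^sup>2" for y
  obtain H where mono: "\<And>x y. 0 < x \<Longrightarrow> x \<le> y \<Longrightarrow> y < b \<Longrightarrow> H x \<le> H y"
    and "\<And>x. x \<in> {0<..<b} \<Longrightarrow> ((\<lambda>x. (wnorm R N (\<lambda>n. d n x))\<^sup>2 / (cosh (q * x))\<^sup>2)
        has_real_derivative H x / (cosh (q * x))\<^sup>2) (at x)"
    by (rule heat_evolution_quotient_deriv[OF d pos(1-3) R(1) _ dcosh dsinh super]) auto
  then have dG: "(G has_real_derivative H y / (cosh (q * y))\<^sup>2) (at y)" if "y \<in> {0<..<b}" for y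
    using that by (simp add: G_def[abs_def])
  have cG: "continuous_on {0..b} G"
    unfolding G_def
    by (intro continuous_intros heat_evolution_continuous[OF d]) auto
  have dG0: "(G has_real_derivative 0) (at_right 0)"
    unfolding G_def[abs_def] wnorm_sq
    by (rule derivative_eq_intros DERIV_sum bc refl | simp)+
  \<comment> \<open>The flux condition is one-sided and \<open>G'\<close> need not extend continuously to \<open>0\<close>. A negative
      value of \<open>H\<close> would, by monotonicity, give a uniformly negative slope of \<open>G\<close> near \<open>0\<close>.\<close>
  have H_nonneg: "0 \<le> H x" if x: "x \<in> {0<..<b}" for x
  proof (rule ccontr)
    assume "\<not> 0 \<le> H x"
    then have neg: "H x < 0" by simp
    define m where "m = H x / (cosh (q * b))\<^sup>2"
    have m: "m < 0" using neg by (simp add: m_def divide_neg_pos)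
    have slope: "(G y - G 0) / (y - 0) \<le> m" if y: "0 < y" "y < x" for y
    proof -
      have "continuous_on {0..y} G" using cG by (rule continuous_on_subset) (use x y in auto)
      moreover have "G differentiable (at t)" if "0 < t" "t < y" for t
        using dG[of t] that x y real_differentiable_def by auto
      ultimately obtain D z where z: "0 < z" "z < y" and "DERIV G z :> D"
        and "G y - G 0 = (y - 0) * D"
        using MVT[of 0 y G] y by blast
      moreover have "D = H z / (cosh (q * z))\<^sup>2"
        using DERIV_unique[OF \<open>DERIV G z :> D\<close> dG] z x y by simp
      ultimately have Gz: "G y - G 0 = (y - 0) * (H z / (cosh (q * z))\<^sup>2)"
        by simp
      have "H z \<le> H x" using mono[of z x] z x y by simp
      then have "H z / (cosh (q * z))\<^sup>2 \<le> H x / (cosh (q * z))\<^sup>2"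
        by (simp add: divide_right_mono)
      also have "\<dots> \<le> m"
      proof -
        have "cosh (q * z) \<le> cosh (q * b)"
          using q0 z x y pos(4) by (subst cosh_real_nonneg_le_iff) (auto intro!: mult_left_mono)
        then show ?thesis
          unfolding m_def using neg
          by (intro divide_left_mono_neg) (auto intro!: power_mono)
      qed
      finally show ?thesis unfolding Gz using y by simp
    qed
    have "0 \<le> m"
    proof (rule tendsto_upperbound)
      show "((\<lambda>y. (G y - G 0) / (y - 0)) \<longlongrightarrow> 0) (at_right 0)"
        using dG0 by (simp add: has_field_derivative_iff)
      show "\<forall>\<^sub>F y in at_right 0. (G y - G 0) / (y - 0) \<le> m"
        using eventually_at_right_real[of 0 x] x slope
        by (auto elim!: eventually_mono)
    qed simp
    with m show False by simp
  qed
  have "G 0 \<le> G b"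
  proof (rule DERIV_nonneg_imp_increasing_open[OF _ _ cG])
    fix y assume "0 < y" "y < b"
    then show "\<exists>D. (G has_real_derivative D) (at y) \<and> 0 \<le> D"
      using dG[of y] H_nonneg[of y] by (auto intro!: exI divide_nonneg_nonneg)
  qed (use pos in simp)
  then have "(wnorm R N (\<lambda>n. d n 0))\<^sup>2 \<le> (wnorm R N (\<lambda>n. d n b) / cosh (q * b))\<^sup>2"
    by (simp add: G_def power_divide)
  then have "wnorm R N (\<lambda>n. d n 0) \<le> wnorm R N (\<lambda>n. d n b) / cosh (q * b)"
    by (rule power2_le_imp_le) (simp add: wnorm_nonneg)
  then show ?thesis by (simp add: q_def mult_ac)
qed

section \<open>One step of the iteration\<close>

text \<open>
  Reflecting and rescaling space by \<open>c\<close> multiplies \<open>lam\<^sub>1 * w1''\<close> by \<open>c\<^sup>2\<close>, so the two heat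
  equations coincide after folding when \<open>c\<^sup>2 * (\<alpha>\<^sub>1 / lam\<^sub>1) = \<alpha>\<^sub>2 / lam\<^sub>2\<close>, and then they can be
  superposed.
\<close>
lemma heat_step_fold:
  assumes 1: "heat_step \<alpha>\<^sub>1 lam\<^sub>1 \<Delta>t (-a) 0 v1 w1" and 2: "heat_step \<alpha>\<^sub>2 lam\<^sub>2 \<Delta>t 0 b v2 w2"
    and c: "c > 0" "c * b \<le> a" and lam: "lam\<^sub>1 > 0" "lam\<^sub>2 > 0"
    and speed: "c\<^sup>2 * (\<alpha>\<^sub>1 / lam\<^sub>1) = \<alpha>\<^sub>2 / lam\<^sub>2"
  shows "heat_step \<alpha>\<^sub>2 lam\<^sub>2 \<Delta>t 0 b (\<lambda>x. v1 (- c * x) + s * v2 x) (\<lambda>x. w1 (- c * x) + s * w2 x)"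
proof -
  have range: "- c * x \<in> {-a..0}" if "x \<in> {0..b}" for x
  proof -
    have "c * x \<le> c * b" using that c by simp
    with c have "c * x \<le> a" by linarith
    with that c show ?thesis by simp
  qed
  have range': "- c * x \<in> {-a<..<0}" if "x \<in> {0<..<b}" for x
  proof -
    have "c * x < c * b" using that c by simp
    with c have "c * x < a" by linarith
    with that c show ?thesis by simp
  qed
  obtain f1 g1 where fg1: "\<And>x. x \<in> {-a<..<0} \<Longrightarrow> (w1 has_real_derivative f1 x) (at x) \<and>
      (f1 has_real_derivative g1 x) (at x) \<and> \<alpha>\<^sub>1 / \<Delta>t * (w1 x - v1 x) - lam\<^sub>1 * g1 x = 0"
    using 1 unfolding heat_step_def by blast
  obtain f2 g2 where fg2: "\<And>x. x \<in> {0<..<b} \<Longrightarrow> (w2 has_real_derivative f2 x) (at x) \<and>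
      (f2 has_real_derivative g2 x) (at x) \<and> \<alpha>\<^sub>2 / \<Delta>t * (w2 x - v2 x) - lam\<^sub>2 * g2 x = 0"
    using 2 unfolding heat_step_def by blast
  have "continuous_on {0..b} (\<lambda>x. w1 (- c * x))"
    using 1 range unfolding heat_step_def
    by (intro continuous_on_compose2[where g = w1 and f = "\<lambda>x. - c * x"] continuous_intros) auto
  then have "continuous_on {0..b} (\<lambda>x. w1 (- c * x) + s * w2 x)"
    using 2 unfolding heat_step_def by (intro continuous_intros) auto
  moreover have "((\<lambda>x. w1 (- c * x) + s * w2 x) has_real_derivative
        - c * f1 (- c * x) + s * f2 x) (at x) \<and>
      ((\<lambda>x. - c * f1 (- c * x) + s * f2 x) has_real_derivative
        c\<^sup>2 * g1 (- c * x) + s * g2 x) (at x) \<and>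
      \<alpha>\<^sub>2 / \<Delta>t * (w1 (- c * x) + s * w2 x - (v1 (- c * x) + s * v2 x))
        - lam\<^sub>2 * (c\<^sup>2 * g1 (- c * x) + s * g2 x) = 0" if x: "x \<in> {0<..<b}" for x
  proof (intro conjI)
    note d1 = fg1[OF range'[OF x]] and d2 = fg2[OF x]
    have inner: "((\<lambda>x. - c * x) has_real_derivative - c) (at x)"
      by (auto intro!: derivative_eq_intros)
    have w1: "((\<lambda>x. w1 (- c * x)) has_real_derivative f1 (- c * x) * - c) (at x)"
      using d1 by (intro DERIV_chain2[OF _ inner]) simp
    have f1: "((\<lambda>x. f1 (- c * x)) has_real_derivative g1 (- c * x) * - c) (at x)"
      using d1 by (intro DERIV_chain2[OF _ inner]) simp
    show "((\<lambda>x. w1 (- c * x) + s * w2 x) has_real_derivative - c * f1 (- c * x) + s * f2 x) (at x)"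
      using DERIV_add[OF w1 DERIV_cmult[of w2 "f2 x" x UNIV s]] d2 by (simp add: mult.commute)
    show "((\<lambda>x. - c * f1 (- c * x) + s * f2 x) has_real_derivative
        c\<^sup>2 * g1 (- c * x) + s * g2 x) (at x)"
      using DERIV_add[OF DERIV_cmult[OF f1, of "- c"] DERIV_cmult[of f2 "g2 x" x UNIV s]] d2
      by (simp add: power2_eq_square mult_ac)
    have g1: "g1 (- c * x) = \<alpha>\<^sub>1 / lam\<^sub>1 * (1 / \<Delta>t * (w1 (- c * x) - v1 (- c * x)))"
    proof -
      have "lam\<^sub>1 * g1 (- c * x) = \<alpha>\<^sub>1 / \<Delta>t * (w1 (- c * x) - v1 (- c * x))"
        using d1 by simp
      then have "g1 (- c * x) = \<alpha>\<^sub>1 / \<Delta>t * (w1 (- c * x) - v1 (- c * x)) / lam\<^sub>1"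
        using lam by (metis less_irrefl nonzero_mult_div_cancel_left)
      then show ?thesis by simp
    qed
    have "lam\<^sub>2 * (c\<^sup>2 * g1 (- c * x))
        = lam\<^sub>2 * (c\<^sup>2 * (\<alpha>\<^sub>1 / lam\<^sub>1)) * (1 / \<Delta>t * (w1 (- c * x) - v1 (- c * x)))"
      unfolding g1 by (simp only: mult_ac)
    also have "\<dots> = \<alpha>\<^sub>2 / \<Delta>t * (w1 (- c * x) - v1 (- c * x))"
      unfolding speed using lam by simp
    finally have "lam\<^sub>2 * (c\<^sup>2 * g1 (- c * x)) = \<alpha>\<^sub>2 / \<Delta>t * (w1 (- c * x) - v1 (- c * x))" .
    moreover have "s * (\<alpha>\<^sub>2 / \<Delta>t * (w2 x - v2 x) - lam\<^sub>2 * g2 x) = 0"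
      using d2 by simp
    ultimately show "\<alpha>\<^sub>2 / \<Delta>t * (w1 (- c * x) + s * w2 x - (v1 (- c * x) + s * v2 x))
        - lam\<^sub>2 * (c\<^sup>2 * g1 (- c * x) + s * g2 x) = 0"
      by (simp add: ring_distribs diff_divide_distrib add_divide_distrib mult_ac)
  qed
  ultimately show ?thesis
    unfolding heat_step_def
    by (intro conjI[OF _ exI[of _ "\<lambda>x. - c * f1 (- c * x) + s * f2 x", OF
        exI[of _ "\<lambda>x. c\<^sup>2 * g1 (- c * x) + s * g2 x", OF ballI]]])
qed

lemma has_real_derivative_reflect_at_right:
  fixes f :: "real \<Rightarrow> real"
  assumes "(f has_real_derivative D) (at_left 0)" and "c > 0"
  shows "((\<lambda>x. f (- c * x)) has_real_derivative - c * D) (at_right 0)"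
proof -
  have "(\<lambda>x. - c * x) ` {0<..} = {..<0}"
  proof (intro equalityI subsetI)
    fix y :: real assume "y \<in> {..<0}"
    then show "y \<in> (\<lambda>x. - c * x) ` {0<..}"
      using assms(2) by (intro image_eqI[of _ _ "- y / c"]) (auto simp: divide_neg_pos)
  qed (use assms(2) in auto)
  with assms(1) have "(f has_real_derivative D) (at (- c * 0) within (\<lambda>x. - c * x) ` {0<..})"
    by simp
  moreover have "((\<lambda>x. - c * x) has_real_derivative - c) (at_right 0)"
    by (auto intro!: derivative_eq_intros)
  ultimately show ?thesis
    using DERIV_image_chain[of f D "\<lambda>x. - c * x" 0 "{0<..}" "- c"]
    by (simp add: o_def mult.commute)
qed

text \<open>
  The constants \<open>c\<close> and \<open>s\<close> of the folded function \<open>d\<close> satisfy \<open>c * lam\<^sub>2 = s * lam\<^sub>1\<close>, which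
  turns the transmission condition into zero flux of \<open>d\<close>, and \<open>\<theta> = (1 - \<theta>) * s\<close>, which turns
  the relaxed update into a multiple of \<open>d n 0\<close>. The Neumann estimate carries \<open>d\<close> from \<open>0\<close> to
  \<open>b\<close>, where \<open>u2\<close> vanishes, and the Dirichlet estimate carries \<open>u1\<close> from \<open>- c * b\<close> to the
  interface. The hypothesis on \<open>a\<close> and \<open>b\<close> places \<open>- c * b\<close> inside the left subdomain.
\<close>
lemma dnwr_step_contraction:
  assumes pos: "a > 0" "b > 0" "\<Delta>t > 0" "\<alpha>\<^sub>1 > 0" "\<alpha>\<^sub>2 > 0" "lam\<^sub>1 > 0" "lam\<^sub>2 > 0"
    and R: "0 \<le> R" "R \<le> 1"
    and \<theta>: "\<theta> = sqrt (\<alpha>\<^sub>2 * lam\<^sub>2) / (sqrt (\<alpha>\<^sub>1 * lam\<^sub>1) + sqrt (\<alpha>\<^sub>2 * lam\<^sub>2))"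
    and ab: "sqrt (\<alpha>\<^sub>1 / lam\<^sub>1) * a > sqrt (\<alpha>\<^sub>2 / lam\<^sub>2) * b"
    and it: "dnwr_error_iteration a b \<alpha>\<^sub>1 lam\<^sub>1 \<alpha>\<^sub>2 lam\<^sub>2 \<Delta>t N \<theta> h u1 u2"
  shows "wnorm R N (h (k + 1)) \<le>
    (1 - sqrt (\<alpha>\<^sub>2 * lam\<^sub>1 / (\<alpha>\<^sub>1 * lam\<^sub>2)) * (b / a)) / (1 + sqrt (\<alpha>\<^sub>2 * lam\<^sub>2 / (\<alpha>\<^sub>1 * lam\<^sub>1)))
    / cosh (b * sqrt (\<alpha>\<^sub>2 / lam\<^sub>2) * sqrt ((1 - R) / \<Delta>t)) * wnorm R N (h k)"
proof -
  define c where "c = sqrt (\<alpha>\<^sub>2 * lam\<^sub>1 / (\<alpha>\<^sub>1 * lam\<^sub>2))"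
  define s where "s = sqrt (\<alpha>\<^sub>2 * lam\<^sub>2 / (\<alpha>\<^sub>1 * lam\<^sub>1))"
  define d where "d n x = u1 (k + 1) n (- c * x) + s * u2 (k + 1) n x" for n x
  have c0: "c > 0" and s0: "s > 0"
    using pos by (simp_all add: c_def s_def)
  have "c\<^sup>2 * (\<alpha>\<^sub>1 / lam\<^sub>1) = \<alpha>\<^sub>2 / lam\<^sub>2"
    using pos by (simp add: c_def)
  note speed = this
  have c_flux: "c * lam\<^sub>2 = s * lam\<^sub>1"
  proof (rule power2_eq_imp_eq)
    show "(c * lam\<^sub>2)\<^sup>2 = (s * lam\<^sub>1)\<^sup>2"
      unfolding power_mult_distrib using pos
      by (simp add: c_def s_def) (simp add: power2_eq_square)
  qed (use c0 s0 pos in auto)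
  have "sqrt (\<alpha>\<^sub>2 / lam\<^sub>2) = c * sqrt (\<alpha>\<^sub>1 / lam\<^sub>1)"
    unfolding speed[symmetric] real_sqrt_mult using c0 by simp
  with ab have "sqrt (\<alpha>\<^sub>1 / lam\<^sub>1) * (c * b) < sqrt (\<alpha>\<^sub>1 / lam\<^sub>1) * a"
    by (simp only: mult_ac)
  then have cb: "c * b < a"
    using pos by (subst (asm) mult_less_cancel_left_pos) auto
  have \<theta>_s: "\<theta> = (1 - \<theta>) * s" and \<theta>_eq: "1 - \<theta> = 1 / (1 + s)" and \<theta>1: "0 \<le> 1 - \<theta>"
  proof -
    have "s = sqrt (\<alpha>\<^sub>2 * lam\<^sub>2) / sqrt (\<alpha>\<^sub>1 * lam\<^sub>1)"
      by (simp add: s_def real_sqrt_divide)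
    moreover have p: "sqrt (\<alpha>\<^sub>1 * lam\<^sub>1) > 0"
      using pos by simp
    ultimately have "sqrt (\<alpha>\<^sub>2 * lam\<^sub>2) = s * sqrt (\<alpha>\<^sub>1 * lam\<^sub>1)"
      using pos by simp
    then have "\<theta> = s * sqrt (\<alpha>\<^sub>1 * lam\<^sub>1) / ((1 + s) * sqrt (\<alpha>\<^sub>1 * lam\<^sub>1))"
      unfolding \<theta> by (simp add: distrib_right)
    then have "\<theta> = s / (1 + s)"
      using pos by simp
    then show eq: "1 - \<theta> = 1 / (1 + s)" and "\<theta> = (1 - \<theta>) * s"
      using s0 by (simp_all add: field_simps)
    show "0 \<le> 1 - \<theta>"
      unfolding eq using s0 by simp
  qed
  have it0: "x \<in> {-a..0} \<Longrightarrow> u1 (k + 1) 0 x = 0" "x \<in> {0..b} \<Longrightarrow> u2 (k + 1) 0 x = 0" for x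
    using it unfolding dnwr_error_iteration_def by blast+
  have itn: "heat_step \<alpha>\<^sub>1 lam\<^sub>1 \<Delta>t (-a) 0 (u1 (k + 1) n) (u1 (k + 1) (n + 1)) \<and>
     u1 (k + 1) (n + 1) (-a) = 0 \<and>
     u1 (k + 1) (n + 1) 0 = h k (n + 1) \<and>
     heat_step \<alpha>\<^sub>2 lam\<^sub>2 \<Delta>t 0 b (u2 (k + 1) n) (u2 (k + 1) (n + 1)) \<and>
     (\<exists>p1 p2. (u1 (k + 1) (n + 1) has_real_derivative p1) (at_left 0) \<and>
              (u2 (k + 1) (n + 1) has_real_derivative p2) (at_right 0) \<and>
              - lam\<^sub>2 * p2 = - lam\<^sub>1 * p1) \<and>
     u2 (k + 1) (n + 1) b = 0 \<and>
     h (k + 1) (n + 1) = (1 - \<theta>) * h k (n + 1) + \<theta> * u2 (k + 1) (n + 1) 0" if "n < N" for n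
    using it that unfolding dnwr_error_iteration_def by blast
  have u1_evo: "heat_evolution \<alpha>\<^sub>1 lam\<^sub>1 \<Delta>t (-a) 0 N (u1 (k + 1))"
    unfolding heat_evolution_def using it0 itn by blast
  have d_evo: "heat_evolution \<alpha>\<^sub>2 lam\<^sub>2 \<Delta>t 0 b N d"
    unfolding heat_evolution_def
  proof (intro conjI ballI allI impI)
    fix x assume x: "x \<in> {0..b}"
    then have "c * x \<le> c * b" using c0 by simp
    with cb have "c * x \<le> a" by linarith
    then have "- c * x \<in> {-a..0}" using x c0 by simp
    then show "d 0 x = 0"
      using it0[of "- c * x"] it0[of x] x by (simp add: d_def)
  next
    fix n assume n: "n < N"
    show "heat_step \<alpha>\<^sub>2 lam\<^sub>2 \<Delta>t 0 b (d n) (d (n + 1))"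
      unfolding d_def[abs_def]
      by (rule heat_step_fold[where a = a and \<alpha>\<^sub>1 = \<alpha>\<^sub>1 and lam\<^sub>1 = lam\<^sub>1])
         (use itn[OF n] c0 cb pos speed in auto)
  qed
  have d_flux: "(d n has_real_derivative 0) (at_right 0)" if n: "1 \<le> n" "n \<le> N" for n
  proof -
    from n have "n - 1 < N" "n - 1 + 1 = n" by auto
    with itn[of "n - 1"] obtain p1 p2 where
      p1: "(u1 (k + 1) n has_real_derivative p1) (at_left 0)" and
      p2: "(u2 (k + 1) n has_real_derivative p2) (at_right 0)" and
      eq: "- lam\<^sub>2 * p2 = - lam\<^sub>1 * p1"
      by metis
    have "lam\<^sub>2 * (c * p1) = lam\<^sub>2 * (s * p2)"
    proof -
      have "lam\<^sub>2 * (c * p1) = c * lam\<^sub>2 * p1" by simp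
      also have "\<dots> = s * (lam\<^sub>1 * p1)" by (simp add: c_flux)
      also have "\<dots> = lam\<^sub>2 * (s * p2)" using eq by simp
      finally show ?thesis .
    qed
    then have "- c * p1 + s * p2 = 0" using pos by simp
    then show ?thesis
      using DERIV_add[OF has_real_derivative_reflect_at_right[OF p1 c0] DERIV_cmult[OF p2, of s]]
      by (simp add: d_def[abs_def])
  qed
  have idx: "u1 (k + 1) n (-a) = 0" "u1 (k + 1) n 0 = h k n" "u2 (k + 1) n b = 0"
      "h (k + 1) n = (1 - \<theta>) * h k n + \<theta> * u2 (k + 1) n 0" if n: "1 \<le> n" "n \<le> N" for n
  proof -
    from n have "n - 1 < N" "n - 1 + 1 = n" by auto
    with itn[of "n - 1"] show "u1 (k + 1) n (-a) = 0" "u1 (k + 1) n 0 = h k n"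
        "u2 (k + 1) n b = 0" "h (k + 1) n = (1 - \<theta>) * h k n + \<theta> * u2 (k + 1) n 0"
      by simp_all
  qed
  define C where "C = cosh (b * sqrt (\<alpha>\<^sub>2 / lam\<^sub>2) * sqrt ((1 - R) / \<Delta>t))"
  have C0: "C > 0" by (simp add: C_def)
  have u1_norm: "wnorm R N (\<lambda>n. d n b) \<le> (1 - c * (b / a)) * wnorm R N (h k)"
  proof -
    have "wnorm R N (\<lambda>n. d n b) = wnorm R N (\<lambda>n. u1 (k + 1) n (- c * b))"
      by (rule wnorm_cong) (use idx in \<open>simp add: d_def\<close>)
    also have "\<dots> \<le> (- c * b - - a) / (0 - - a) * wnorm R N (\<lambda>n. u1 (k + 1) n 0)"
      by (rule heat_dirichlet_contraction[OF u1_evo]) (use pos R c0 cb idx in auto)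
    also have "wnorm R N (\<lambda>n. u1 (k + 1) n 0) = wnorm R N (h k)"
      by (rule wnorm_cong) (use idx in simp)
    also have "(- c * b - - a) / (0 - - a) = 1 - c * (b / a)"
      using pos by (simp add: field_simps)
    finally show ?thesis .
  qed
  have "wnorm R N (h (k + 1)) = wnorm R N (\<lambda>n. (1 - \<theta>) * d n 0)"
  proof (rule wnorm_cong)
    fix n assume n: "1 \<le> n" "n \<le> N"
    have "\<theta> * u2 (k + 1) n 0 = (1 - \<theta>) * (s * u2 (k + 1) n 0)"
      by (subst \<theta>_s) (simp only: mult.assoc)
    with idx[OF n] show "h (k + 1) n = (1 - \<theta>) * d n 0"
      by (simp add: d_def distrib_left)
  qed
  also have "\<dots> = (1 - \<theta>) * wnorm R N (\<lambda>n. d n 0)"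
    using \<theta>1 by (rule wnorm_scale)
  also have "\<dots> \<le> (1 - \<theta>) * (wnorm R N (\<lambda>n. d n b) / C)"
    unfolding C_def
    by (intro mult_left_mono \<theta>1 heat_neumann_contraction[OF d_evo] pos R d_flux)
  also have "\<dots> \<le> (1 - \<theta>) * ((1 - c * (b / a)) * wnorm R N (h k) / C)"
    using C0 by (intro mult_left_mono \<theta>1 divide_right_mono u1_norm) simp
  finally have "wnorm R N (h (k + 1)) \<le> (1 - \<theta>) * ((1 - c * (b / a)) * wnorm R N (h k) / C)" .
  then show ?thesis
    unfolding \<theta>_eq C_def[symmetric] c_def[symmetric] s_def[symmetric] by simp
qed

section \<open>Convergence of the iteration\<close>

lemma inverse_cosh_le: "1 / cosh (x::real) \<le> 2 * exp (- x)"
proof -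
  have "exp x \<le> 2 * cosh x" by (simp add: cosh_field_def)
  then show ?thesis by (simp add: exp_minus field_simps)
qed

theorem theorem5:
  fixes a b T \<alpha>\<^sub>1 \<alpha>\<^sub>2 lam\<^sub>1 lam\<^sub>2 \<theta> \<Delta>t :: real
    and N k :: nat
    and h :: "nat \<Rightarrow> nat \<Rightarrow> real"
    and u1 u2 :: "nat \<Rightarrow> nat \<Rightarrow> real \<Rightarrow> real"
  assumes "a > 0" and "b > 0" and "T > 0"
    and "\<alpha>\<^sub>1 > 0" and "\<alpha>\<^sub>2 > 0" and "lam\<^sub>1 > 0" and "lam\<^sub>2 > 0"
    and "N \<ge> 1" and "\<Delta>t = T / real N"
    and "\<theta> = sqrt (\<alpha>\<^sub>2 * lam\<^sub>2) / (sqrt (\<alpha>\<^sub>1 * lam\<^sub>1) + sqrt (\<alpha>\<^sub>2 * lam\<^sub>2))"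
    and "sqrt (\<alpha>\<^sub>1 / lam\<^sub>1) * a > sqrt (\<alpha>\<^sub>2 / lam\<^sub>2) * b"
    and "dnwr_error_iteration a b \<alpha>\<^sub>1 lam\<^sub>1 \<alpha>\<^sub>2 lam\<^sub>2 \<Delta>t N \<theta> h u1 u2"
    and "k \<ge> 1"
  shows "L2_set (h k) {1..N} \<le>
    (2 * ((1 - sqrt (\<alpha>\<^sub>2 * lam\<^sub>1 / (\<alpha>\<^sub>1 * lam\<^sub>2)) * (b / a)) /
          (1 + sqrt (\<alpha>\<^sub>2 * lam\<^sub>2 / (\<alpha>\<^sub>1 * lam\<^sub>1))))) ^ k
    * phi1 b \<alpha>\<^sub>2 lam\<^sub>2 T \<Delta>t k (r1d b \<alpha>\<^sub>2 lam\<^sub>2 T \<Delta>t k) * L2_set (h 0) {1..N}"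
proof -
  define r where "r = r1d b \<alpha>\<^sub>2 lam\<^sub>2 T \<Delta>t k"
  define R where "R = exp (- r * \<Delta>t)"
  define E where "E = exp (- (b * sqrt (\<alpha>\<^sub>2 / lam\<^sub>2) * sqrt ((1 - R) / \<Delta>t)))"
  define \<gamma> where "\<gamma> = (1 - sqrt (\<alpha>\<^sub>2 * lam\<^sub>1 / (\<alpha>\<^sub>1 * lam\<^sub>2)) * (b / a)) /
    (1 + sqrt (\<alpha>\<^sub>2 * lam\<^sub>2 / (\<alpha>\<^sub>1 * lam\<^sub>1)))"
  have dt: "\<Delta>t > 0" using assms by simp
  have "0 \<le> r"
    unfolding r_def r1d_def using assms(7) dt assms(5) by simp
  then have R: "0 < R" "R \<le> 1" using dt by (simp_all add: R_def)
  have \<gamma>: "0 \<le> \<gamma>"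
  proof -
    have "sqrt (\<alpha>\<^sub>2 * lam\<^sub>1 / (\<alpha>\<^sub>1 * lam\<^sub>2)) * sqrt (\<alpha>\<^sub>1 / lam\<^sub>1) = sqrt (\<alpha>\<^sub>2 / lam\<^sub>2)"
      unfolding real_sqrt_mult[symmetric] using assms(4-7) by simp
    then have "sqrt (\<alpha>\<^sub>2 * lam\<^sub>1 / (\<alpha>\<^sub>1 * lam\<^sub>2)) * b * sqrt (\<alpha>\<^sub>1 / lam\<^sub>1) = sqrt (\<alpha>\<^sub>2 / lam\<^sub>2) * b"
      by (metis mult.assoc mult.commute)
    also have "\<dots> \<le> a * sqrt (\<alpha>\<^sub>1 / lam\<^sub>1)"
      using assms(11) by (simp add: mult.commute)
    finally have "sqrt (\<alpha>\<^sub>2 * lam\<^sub>1 / (\<alpha>\<^sub>1 * lam\<^sub>2)) * b \<le> a"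
      using assms(4,6) by (subst (asm) mult_le_cancel_right_pos) auto
    then show ?thesis
      using assms(1) assms(4-7) by (simp add: \<gamma>_def)
  qed
  have step: "wnorm R N (h (j + 1)) \<le> 2 * \<gamma> * E * wnorm R N (h j)" for j
  proof -
    have "wnorm R N (h (j + 1))
        \<le> \<gamma> / cosh (b * sqrt (\<alpha>\<^sub>2 / lam\<^sub>2) * sqrt ((1 - R) / \<Delta>t)) * wnorm R N (h j)"
      unfolding \<gamma>_def
      by (rule dnwr_step_contraction) (use assms dt R in auto)
    also have "\<dots> \<le> 2 * \<gamma> * E * wnorm R N (h j)"
      using mult_left_mono[OF inverse_cosh_le \<gamma>]
      by (intro mult_right_mono wnorm_nonneg) (simp add: E_def mult_ac)
    finally show ?thesis .
  qed
  have iter: "wnorm R N (h j) \<le> (2 * \<gamma> * E) ^ j * wnorm R N (h 0)" for j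
  proof (induction j)
    case (Suc j)
    have "0 \<le> 2 * \<gamma> * E" using \<gamma> by (simp add: E_def)
    from mult_left_mono[OF Suc this] step[of j] show ?case by (simp add: mult_ac)
  qed simp
  have RN: "R ^ N * exp (r * T) = 1"
  proof -
    have "R ^ N = exp (- (r * T))"
      using assms(8,9) by (simp add: R_def exp_of_nat_mult[symmetric])
    then show ?thesis by (simp add: exp_minus)
  qed
  have phi: "phi1 b \<alpha>\<^sub>2 lam\<^sub>2 T \<Delta>t k r = exp (r * T) * E ^ k"
    by (simp add: phi1_def E_def R_def exp_of_nat_mult[symmetric] exp_add[symmetric] mult_ac)
  have "L2_set (h k) {1..N} = exp (r * T) * (R ^ N * L2_set (h k) {1..N})"
    using RN by (metis mult.assoc mult.commute mult_1)
  also have "\<dots> \<le> exp (r * T) * wnorm R N (h k)"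
    by (intro mult_left_mono L2_set_le_wnorm R) simp
  also have "\<dots> \<le> exp (r * T) * ((2 * \<gamma> * E) ^ k * wnorm R N (h 0))"
    by (intro mult_left_mono iter) simp
  also have "\<dots> \<le> exp (r * T) * ((2 * \<gamma> * E) ^ k * L2_set (h 0) {1..N})"
    using \<gamma> R by (intro mult_left_mono wnorm_le_L2_set zero_le_power) (auto simp: E_def)
  also have "\<dots> = (2 * \<gamma>) ^ k * phi1 b \<alpha>\<^sub>2 lam\<^sub>2 T \<Delta>t k r * L2_set (h 0) {1..N}"
    by (simp add: phi power_mult_distrib)
  finally show ?thesis
    unfolding r_def \<gamma>_def .
qed

end
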